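(* Let $n,r$ be positive integers, $G_r=2^r+1$, and $a,s\in\{1,\dots,2^n-2\}$ with binary expansions $a=\sum_{i=0}^{n-1}a_i2^i$ and $s=\sum_{i=0}^{n-1}s_i2^i$. The following are equivalent: (a) $s\equiv G_r\cdot a\pmod{2^n-1}$; (b) there exists a sequence $(c_{n-1},\dots,c_0)$ with $c_i\in\{0,1\}$ such that $2c_i-c_{i-1}+s_i=a_{i-r}+a_i$ for all $i$, where indices are taken modulo $n$. Moreover, the sequence $c$ in (b) is unique. *)

theory Defs
  imports "HOL-Number_Theory.Cong" "HOL-Library.FuncSet"
begin

definition G :: "nat \<Rightarrow> int" where
  "G r = 2 ^ r + 1"

text \<open>Digits are indexed by \<open>{0..<n}\<close>; \<open>d\<close> is unconstrained outside this range.\<close>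

definition binary_expansion :: "nat \<Rightarrow> (nat \<Rightarrow> int) \<Rightarrow> int \<Rightarrow> bool" where
  "binary_expansion n d x \<longleftrightarrow> (\<forall>i<n. d i \<in> {0, 1}) \<and> x = (\<Sum>i<n. d i * 2 ^ i)"

text \<open>The representative in \<open>{0..<n}\<close> of the index \<open>k\<close> taken modulo \<open>n\<close> (for positive \<open>n\<close>).\<close>

definition idx :: "nat \<Rightarrow> int \<Rightarrow> nat" where
  "idx n k = nat (k mod int n)"

text \<open>The extensional function space makes \<open>c\<close> a sequence of exactly \<open>n\<close> entries, so that
  equality of functions is equality of sequences.\<close>

definition carry_sequence ::
    "nat \<Rightarrow> nat \<Rightarrow> (nat \<Rightarrow> int) \<Rightarrow> (nat \<Rightarrow> int) \<Rightarrow> (nat \<Rightarrow> int) \<Rightarrow> bool" where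
  "carry_sequence n r da ds c \<longleftrightarrow>
     c \<in> {0..<n} \<rightarrow>\<^sub>E {0, 1} \<and>
     (\<forall>i<n. 2 * c i - c (idx n (int i - 1)) + ds i = da (idx n (int i - int r)) + da i)"

end

theory Submission
  imports Defs
begin

text \<open>Writing \<open>b\<^sub>i = a\<^sub>i\<^sub>-\<^sub>r + a\<^sub>i - s\<^sub>i\<close>, the recurrence \<open>2c\<^sub>i - c\<^sub>i\<^sub>-\<^sub>1 = b\<^sub>i\<close> telescopes to
  \<open>2\<^sup>m c\<^sub>m\<^sub>-\<^sub>1 = c\<^sub>n\<^sub>-\<^sub>1 + \<Sum>\<^sub>j\<^sub><\<^sub>m b\<^sub>j 2\<^sup>j\<close>. For \<open>m = n\<close> this reads \<open>(2\<^sup>n - 1) c\<^sub>n\<^sub>-\<^sub>1 = \<Sum>\<^sub>j b\<^sub>j 2\<^sup>j\<close>, whose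
  right-hand side is congruent to \<open>G\<^sub>r a - s\<close> because rotating the digits by \<open>r\<close> multiplies by \<open>2\<^sup>r\<close>
  modulo \<open>2\<^sup>n - 1\<close>. This gives (b) implies (a), and uniqueness. Conversely, under (a) the sum is
  \<open>K (2\<^sup>n - 1)\<close>, the ranges of \<open>a\<close> and \<open>s\<close> force \<open>K \<in> {0, 1}\<close>, and the telescoped formula with
  \<open>c\<^sub>n\<^sub>-\<^sub>1 = K\<close> defines integers \<open>c\<^sub>i\<close>, which stay in \<open>{0, 1}\<close> because \<open>-1 \<le> b\<^sub>i \<le> 2\<close>.\<close>

lemma idx_pred_0: "n > 0 \<Longrightarrow> idx n (int 0 - 1) = n - 1"
  by (simp add: idx_def zmod_minus1 nat_diff_distrib)

lemma idx_pred_Suc: "i < n \<Longrightarrow> idx n (int (Suc i) - 1) = i"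
  by (simp add: idx_def)

lemma idx_less: "n > 0 \<Longrightarrow> idx n k < n"
  by (simp add: idx_def nat_less_iff)

lemma idx_rotate: "j < n \<Longrightarrow> idx n (int ((j + r) mod n) - int r) = j"
  by (simp add: idx_def zmod_int mod_diff_left_eq)

lemma bij_betw_rotate: "bij_betw (\<lambda>j. (j + r) mod n) {..<n} {..<n::nat}"
proof -
  have "inj_on (\<lambda>j. (j + r) mod n) {..<n}"
    by (rule inj_on_inverseI[where g = "\<lambda>i. idx n (int i - int r)"]) (simp add: idx_rotate)
  moreover have "(\<lambda>j. (j + r) mod n) ` {..<n} \<subseteq> {..<n}"
    by (auto intro: mod_less_divisor)
  ultimately show ?thesis
    by (simp add: bij_betw_def endo_inj_surj)
qed

lemma cong_power2_mod: "[2 ^ (k mod n) = 2 ^ k] (mod (2 ^ n - 1 :: int))"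
proof -
  have "[2 ^ n = 1] (mod (2 ^ n - 1 :: int))"
    by (simp add: cong_iff_dvd_diff)
  then have "[(2 ^ n) ^ (k div n) * 2 ^ (k mod n) = 1 ^ (k div n) * 2 ^ (k mod n)] (mod (2 ^ n - 1 :: int))"
    by (intro cong_mult cong_pow cong_refl)
  moreover have "(2 ^ n) ^ (k div n) * 2 ^ (k mod n) = (2 ^ k :: int)"
    by (simp flip: power_mult power_add)
  ultimately show ?thesis
    by (simp add: cong_sym)
qed

lemma cong_sum_rotate:
  "[(\<Sum>i<n. d (idx n (int i - int r)) * 2 ^ i) = 2 ^ r * (\<Sum>i<n. d i * 2 ^ i)] (mod (2 ^ n - 1 :: int))"
proof -
  have "(\<Sum>i<n. d (idx n (int i - int r)) * 2 ^ i) = (\<Sum>j<n. d j * 2 ^ ((j + r) mod n))"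
    by (subst sum.reindex_bij_betw[OF bij_betw_rotate[of r n], symmetric]) (simp add: idx_rotate)
  moreover have "[(\<Sum>j<n. d j * 2 ^ ((j + r) mod n)) = (\<Sum>j<n. d j * 2 ^ (j + r))] (mod (2 ^ n - 1 :: int))"
    by (intro cong_sum cong_mult cong_refl cong_power2_mod)
  moreover have "(\<Sum>j<n. d j * 2 ^ (j + r)) = 2 ^ r * (\<Sum>j<n. d j * 2 ^ j)"
    by (simp add: sum_distrib_left power_add mult_ac)
  ultimately show ?thesis by simp
qed

lemma binary_sum_bounds:
  fixes d :: "nat \<Rightarrow> int"
  assumes "\<And>i. i < n \<Longrightarrow> d i \<in> {0, 1}"
  shows "(\<Sum>i<n. d i * 2 ^ i) \<in> {0..2 ^ n - 1}"
  using assms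
proof (induction n)
  case (Suc n)
  then have "(\<Sum>i<n. d i * 2 ^ i) \<in> {0..2 ^ n - 1}" and "d n \<in> {0, 1}" by simp_all
  then show ?case by auto
qed simp

text \<open>The cyclic index lets the induction start at \<open>m = 0\<close>, where both sides are
  \<open>c (n - 1)\<close>; each step multiplies the recurrence at \<open>m\<close> by
  \<open>2 ^ m\<close>.\<close>

lemma carry_telescope:
  fixes b c :: "nat \<Rightarrow> int"
  assumes "n > 0" and "\<forall>i<n. 2 * c i - c (idx n (int i - 1)) = b i" and "m \<le> n"
  shows "2 ^ m * c (idx n (int m - 1)) = c (n - 1) + (\<Sum>j<m. b j * 2 ^ j)"
  using assms(3)
proof (induction m)
  case 0
  show ?case using idx_pred_0[OF assms(1)] by simp
next
  case (Suc m)
  then have "2 * c m = c (idx n (int m - 1)) + b m" and "idx n (int (Suc m) - 1) = m"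
    using assms(2) idx_pred_Suc[of m n] by (simp_all add: algebra_simps)
  then have "2 ^ Suc m * c (idx n (int (Suc m) - 1)) = 2 ^ m * (c (idx n (int m - 1)) + b m)"
    by (simp only: power_Suc2 mult.assoc)
  with Suc show ?case by (simp add: distrib_left mult.commute)
qed

lemma carry_last:
  fixes b c :: "nat \<Rightarrow> int"
  assumes "n > 0" and "\<forall>i<n. 2 * c i - c (idx n (int i - 1)) = b i"
  shows "(2 ^ n - 1) * c (n - 1) = (\<Sum>j<n. b j * 2 ^ j)"
proof -
  have "idx n (int n - 1) = n - 1"
    using idx_pred_Suc[of "n - 1" n] assms(1) by simp
  with carry_telescope[OF assms, where m = n] show ?thesis
    by (simp add: algebra_simps)
qed

text \<open>As \<open>2 ^ n - 1\<close> is nonzero, \<open>b\<close> determines the last entry, and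
  telescoping to \<open>Suc i\<close> then determines entry \<open>i\<close>.\<close>

lemma carry_unique:
  fixes b c c' :: "nat \<Rightarrow> int"
  assumes "n > 0"
    and c: "\<forall>i<n. 2 * c i - c (idx n (int i - 1)) = b i"
    and c': "\<forall>i<n. 2 * c' i - c' (idx n (int i - 1)) = b i"
    and "i < n"
  shows "c i = c' i"
proof -
  have "(2 ^ n - 1) * c (n - 1) = (2 ^ n - 1) * c' (n - 1)"
    using carry_last[OF assms(1) c] carry_last[OF assms(1) c'] by simp
  then have "c (n - 1) = c' (n - 1)"
    using assms(1) by simp
  then have "2 ^ Suc i * c i = 2 ^ Suc i * c' i"
    using carry_telescope[OF assms(1) c, where m = "Suc i"]
      carry_telescope[OF assms(1) c', where m = "Suc i"] assms(4)
    by (simp only: idx_pred_Suc Suc_leI)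
  then show ?thesis by simp
qed

lemma carry_exists:
  fixes b :: "nat \<Rightarrow> int"
  assumes "n > 0" and b: "\<And>i. i < n \<Longrightarrow> b i \<in> {-1..2}"
    and K: "K \<in> {0, 1}" and sum: "(\<Sum>j<n. b j * 2 ^ j) = K * (2 ^ n - 1)"
  obtains c where "c \<in> {0..<n} \<rightarrow>\<^sub>E {0, 1}"
    and "\<forall>i<n. 2 * c i - c (idx n (int i - 1)) = b i"
proof -
  \<comment> \<open>\<open>e m\<close> stands for the carry with index \<open>m - 1\<close>, so
    \<open>e 0\<close> and \<open>e n\<close> both stand for the last carry and must agree.\<close>
  define e where "e m = (K + (\<Sum>j<m. b j * 2 ^ j)) div 2 ^ m" for m
  \<comment> \<open>Subtracting the tail from the full sum leaves only terms with exponent at least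
    \<open>m\<close>, so the division in \<open>e\<close> is exact.\<close>
  have dvd: "2 ^ m dvd K + (\<Sum>j<m. b j * 2 ^ j)" if "m \<le> n" for m
  proof -
    have "(\<Sum>j<n. b j * 2 ^ j) = (\<Sum>j<m. b j * 2 ^ j) + (\<Sum>j=m..<n. b j * 2 ^ j)"
      using that by (simp add: lessThan_atLeast0 sum.atLeastLessThan_concat)
    then have "K + (\<Sum>j<m. b j * 2 ^ j) = K * 2 ^ n - (\<Sum>j=m..<n. b j * 2 ^ j)"
      using sum by (simp add: algebra_simps)
    moreover have "2 ^ m dvd K * 2 ^ n - (\<Sum>j=m..<n. b j * 2 ^ j)"
      using that by (intro dvd_diff dvd_sum dvd_mult le_imp_power_dvd) auto
    ultimately show ?thesis by simp
  qed
  have e: "2 ^ m * e m = K + (\<Sum>j<m. b j * 2 ^ j)" if "m \<le> n" for m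
    using dvd[OF that] by (simp add: e_def)
  have rec: "2 * e (Suc i) - e i = b i" if "i < n" for i
  proof -
    have "2 ^ i * (2 * e (Suc i)) = 2 ^ i * (e i + b i)"
      using e[of i] e[of "Suc i"] that by (simp add: algebra_simps)
    then show ?thesis by simp
  qed
  have e0: "e 0 = K" by (simp add: e_def)
  have en: "e n = K"
    using e[of n] sum by (simp add: algebra_simps)
  have range: "e m \<in> {0, 1}" if "m \<le> n" for m
    using that
  proof (induction m)
    case 0
    then show ?case using e0 K by simp
  next
    case (Suc m)
    \<comment> \<open>The even number \<open>2 * e (Suc m)\<close> lies between -1 and 3, hence is 0
      or 2.\<close>
    then have "e m \<in> {0, 1}" "b m \<in> {-1..2}" "2 * e (Suc m) - e m = b m"
      using b rec by simp_all
    then show ?case by auto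
  qed
  define c where "c = restrict (\<lambda>i. e (Suc i)) {0..<n}"
  have pred: "c (idx n (int i - 1)) = e i" if "i < n" for i
  proof (cases i)
    case 0
    then show ?thesis
      using assms(1) e0 en idx_pred_0[of n] by (simp add: c_def)
  next
    case (Suc k)
    then show ?thesis
      using that idx_pred_Suc[of k n] by (simp add: c_def)
  qed
  show thesis
  proof
    show "c \<in> {0..<n} \<rightarrow>\<^sub>E {0, 1}"
      using range by (auto simp: c_def)
    show "\<forall>i<n. 2 * c i - c (idx n (int i - 1)) = b i"
      using pred rec by (simp add: c_def)
  qed
qed

theorem theorem2:
  fixes n r :: nat and a s :: int and da ds :: "nat \<Rightarrow> int"
  assumes "n > 0" and "r > 0"
    and "a \<in> {1..2 ^ n - 2}" and "s \<in> {1..2 ^ n - 2}"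
    and "binary_expansion n da a" and "binary_expansion n ds s"
  shows "([s = G r * a] (mod (2 ^ n - 1)) \<longleftrightarrow> (\<exists>c. carry_sequence n r da ds c)) \<and>
         (\<forall>c c'. carry_sequence n r da ds c \<longrightarrow> carry_sequence n r da ds c' \<longrightarrow> c = c')"
proof -
  define b where "b i = da (idx n (int i - int r)) + da i - ds i" for i
  define R where "R = (\<Sum>i<n. da (idx n (int i - int r)) * 2 ^ i)"
  have da: "da i \<in> {0, 1}" and ds: "ds i \<in> {0, 1}" if "i < n" for i
    using assms(5,6) that by (simp_all add: binary_expansion_def)
  have a: "a = (\<Sum>i<n. da i * 2 ^ i)" and s: "s = (\<Sum>i<n. ds i * 2 ^ i)"
    using assms(5,6) by (simp_all add: binary_expansion_def)
  have sum_b: "(\<Sum>i<n. b i * 2 ^ i) = R + a - s"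
    by (simp add: b_def R_def a s algebra_simps sum.distrib sum_subtractf)
  have da_idx: "da (idx n (int i - int r)) \<in> {0, 1}" for i
    using da idx_less[OF assms(1)] by blast
  have carry_iff: "carry_sequence n r da ds c \<longleftrightarrow>
      c \<in> {0..<n} \<rightarrow>\<^sub>E {0, 1} \<and> (\<forall>i<n. 2 * c i - c (idx n (int i - 1)) = b i)" for c
    by (auto simp: carry_sequence_def b_def algebra_simps)
  have "[R + a = G r * a] (mod (2 ^ n - 1))"
    using cong_add[OF cong_sum_rotate[of da n r] cong_refl[of a]]
    by (simp add: R_def G_def a algebra_simps)
  then have "[s = G r * a] (mod (2 ^ n - 1)) \<longleftrightarrow> [R + a = s] (mod (2 ^ n - 1))"
    by (meson cong_sym cong_trans)
  then have cong_iff: "[s = G r * a] (mod (2 ^ n - 1)) \<longleftrightarrow> 2 ^ n - 1 dvd (\<Sum>i<n. b i * 2 ^ i)"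
    by (simp add: sum_b cong_iff_dvd_diff)
  show ?thesis
  proof (intro conjI iffI allI impI)
    assume "[s = G r * a] (mod (2 ^ n - 1))"
    then obtain K where K: "(\<Sum>i<n. b i * 2 ^ i) = K * (2 ^ n - 1)"
      unfolding cong_iff by (metis dvdE mult.commute)
    have "R \<in> {0..2 ^ n - 1}"
      unfolding R_def using da_idx by (rule binary_sum_bounds)
    \<comment> \<open>Both bounds are strict because \<open>a\<close> and \<open>s\<close> lie in
      \<open>{1..2 ^ n - 2}\<close>, so \<open>a - s\<close> has absolute value at most
      \<open>2 ^ n - 3\<close>.\<close>
    then have "(-1) * (2 ^ n - 1) < K * (2 ^ n - 1)" and "K * (2 ^ n - 1) < 2 * (2 ^ n - 1 :: int)"
      using assms(3,4) by (simp_all flip: K add: sum_b)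
    moreover have "(2 ^ n - 1 :: int) > 0"
      using assms(1) by simp
    ultimately have "-1 < K" and "K < 2"
      by (metis mult_less_cancel_right_pos)+
    then have "K \<in> {0, 1}" by auto
    moreover have "b i \<in> {-1..2}" if "i < n" for i
      using da[OF that] ds[OF that] da_idx[of i] by (auto simp: b_def)
    ultimately show "\<exists>c. carry_sequence n r da ds c"
      unfolding carry_iff using carry_exists[OF assms(1) _ _ K] by metis
  next
    assume "\<exists>c. carry_sequence n r da ds c"
    then obtain c where "\<forall>i<n. 2 * c i - c (idx n (int i - 1)) = b i"
      by (auto simp: carry_iff)
    from carry_last[OF assms(1) this] show "[s = G r * a] (mod (2 ^ n - 1))"
      unfolding cong_iff by (metis dvd_triv_left)
  next
    fix c c'
    assume "carry_sequence n r da ds c" and "carry_sequence n r da ds c'"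
    then have c: "c \<in> {0..<n} \<rightarrow>\<^sub>E {0, 1}" "\<forall>i<n. 2 * c i - c (idx n (int i - 1)) = b i"
      and c': "c' \<in> {0..<n} \<rightarrow>\<^sub>E {0, 1}" "\<forall>i<n. 2 * c' i - c' (idx n (int i - 1)) = b i"
      by (auto simp: carry_iff)
    \<comment> \<open>Agreement below \<open>n\<close> suffices, since both functions are
      extensional on \<open>{0..<n}\<close>.\<close>
    show "c = c'"
      using c(1) c'(1) carry_unique[OF assms(1) c(2) c'(2)] by (intro PiE_ext) auto
  qed
qed

end
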